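(* Let $n \geq 1$, and let $\mathbf{q} = (q_0, \dots, q_n)$ be positive integers with $\gcd(q_0, \dots, q_n) = 1$. Let $N_{\mathbf{q}}(B)$ denote the number of tuples $y \in \mathbb{Z}_{\geq 1}^{n+1}$ with $\max_i y_i \leq B$ whose valuation vector $(v_p(y_0),\dots,v_p(y_n))$ lies in $M_{\mathbf{q}}$ for every prime $p$, and let $a(\mathbf{q})$ and $\beta(\mathbf{q})$ be the value and the dimension of the optimal face of the linear program attached to $\mathbf{q}$ (see context). Then, for $B \geq 2$, $$N_{\mathbf{q}}(B) \gg B^{\,a(\mathbf{q})} (\log B)^{\beta(\mathbf{q})}.$$
   Context: Put $q=\operatorname{lcm}(q_0,\dots,q_n)$, $n_i = q/q_i$ and $$M_{\mathbf{q}} = \{ t \in \mathbb{Z}_{\geq 0}^{n+1} : \min_i t_i = 0,\ t_i \equiv t_j \!\!\pmod{\gcd(n_i,n_j)} \text{ for all } i,j \}.$$ $T_{\mathbf{q}}$ is the (finite) set of minimal elements of $M_{\mathbf{q}} \setminus \{0\}$ for the coordinatewise partial order. The linear program is: maximize $\sum_{g \in T_{\mathbf{q}}} c_g$ subject to $c_g \geq 0$ and $\sum_{g \in T_{\mathbf{q}}} c_g g_i \leq 1$ for $0 \leq i \leq n$; $a(\mathbf{q})$ is its optimal value and $\beta(\mathbf{q})$ the dimension of its face of optimal solutions. The implied constant in $\gg$ is positive and may depend on $\mathbf{q}$. *)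

theory Defs
  imports
    "HOL-Analysis.Analysis"
    "HOL-Analysis.Finite_Function_Topology"
    "HOL-Number_Theory.Number_Theory"
begin

text \<open>
  A tuple with index set $\{0, \dots, n\}$ is a function on \<^typ>\<open>nat\<close>. Vectors in
  $\mathbb{Z}_{\geq 0}^{n+1}$ are extended by zero beyond \<open>n\<close>, so that the pointwise order on
  functions is the coordinatewise order.
\<close>

definition cofactor :: "nat \<Rightarrow> (nat \<Rightarrow> nat) \<Rightarrow> nat \<Rightarrow> nat" where
  "cofactor n q i = (LCM j\<in>{0..n}. q j) div q i"

definition Mset :: "nat \<Rightarrow> (nat \<Rightarrow> nat) \<Rightarrow> (nat \<Rightarrow> nat) set" where
  "Mset n q = {t. (\<forall>i>n. t i = 0) \<and> (MIN i\<in>{0..n}. t i) = 0 \<and>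
     (\<forall>i\<le>n. \<forall>j\<le>n. [t i = t j] (mod gcd (cofactor n q i) (cofactor n q j)))}"

definition Tset :: "nat \<Rightarrow> (nat \<Rightarrow> nat) \<Rightarrow> (nat \<Rightarrow> nat) set" where
  "Tset n q = {g \<in> Mset n q - {\<lambda>_. 0}. \<forall>h \<in> Mset n q - {\<lambda>_. 0}. h \<le> g \<longrightarrow> h = g}"

text \<open>
  The space $\mathbb{R}^T$ is realised inside the finitely supported functions, as those whose
  support lies in \<open>T\<close>; this type, unlike the plain function type, is a \<^class>\<open>real_vector\<close>.
\<close>

definition lp_feasible :: "nat \<Rightarrow> (nat \<Rightarrow> nat) \<Rightarrow> ((nat \<Rightarrow> nat) \<Rightarrow>\<^sub>0 real) set" where
  "lp_feasible n q = {c. Poly_Mapping.keys c \<subseteq> Tset n q \<and>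
     (\<forall>g \<in> Tset n q. Poly_Mapping.lookup c g \<ge> 0) \<and>
     (\<forall>i\<le>n. (\<Sum>g \<in> Tset n q. Poly_Mapping.lookup c g * real (g i)) \<le> 1)}"

definition lp_objective :: "nat \<Rightarrow> (nat \<Rightarrow> nat) \<Rightarrow> ((nat \<Rightarrow> nat) \<Rightarrow>\<^sub>0 real) \<Rightarrow> real" where
  "lp_objective n q c = (\<Sum>g \<in> Tset n q. Poly_Mapping.lookup c g)"

definition lp_value :: "nat \<Rightarrow> (nat \<Rightarrow> nat) \<Rightarrow> real" where
  "lp_value n q = (SUP c \<in> lp_feasible n q. lp_objective n q c)"

definition lp_optimal_face :: "nat \<Rightarrow> (nat \<Rightarrow> nat) \<Rightarrow> ((nat \<Rightarrow> nat) \<Rightarrow>\<^sub>0 real) set" where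
  "lp_optimal_face n q = {c \<in> lp_feasible n q. lp_objective n q c = lp_value n q}"

text \<open>
  The dimension of a nonempty convex set is the linear dimension of the direction space of its
  affine hull, which is spanned by the differences of points of the set. The library's
  \<^const>\<open>aff_dim\<close> is not available here because it is restricted to \<^class>\<open>euclidean_space\<close>.
\<close>

definition lp_face_dim :: "nat \<Rightarrow> (nat \<Rightarrow> nat) \<Rightarrow> nat" where
  "lp_face_dim n q = dim {c - d | c d. c \<in> lp_optimal_face n q \<and> d \<in> lp_optimal_face n q}"

definition point_count :: "nat \<Rightarrow> (nat \<Rightarrow> nat) \<Rightarrow> real \<Rightarrow> nat" where
  "point_count n q B = card {y \<in> {0..n} \<rightarrow>\<^sub>E {1..}.
     real (MAX i\<in>{0..n}. y i) \<le> B \<and>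
     (\<forall>p. prime p \<longrightarrow> (\<lambda>i. if i \<le> n then multiplicity p (y i) else 0) \<in> Mset n q)}"

end

theory Submission
  imports Defs "HOL-Computational_Algebra.Squarefree"
begin

text \<open>
  Choose pairwise coprime squarefree numbers $m_g$, one for each $g \in T_{\mathbf q}$, and put
  $y_i = \prod_g m_g^{g_i}$. A prime dividing $m_g$ has valuation vector exactly $g$ and all other
  primes have valuation vector $0$, so $y$ is counted and determines the $m_g$. With $m_g$ of size
  about $2^{e_g}$, the condition $y_i \le B$ becomes $\sum_g e_g g_i \le \log_2 B - O(1)$, and a
  positive proportion of the about $2^{\sum_g e_g}$ tuples in such a dyadic box is coprime and
  squarefree. It remains to find $\gg (\log B)^\beta$ integer vectors $e$ with
  $\sum_g e_g \ge a \log_2 B - O(1)$: they are obtained by rounding the points of the optimal face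
  dilated by $\log_2 B - O(1)$, spaced along a basis of its direction space.

  Coordinates that vanish on the whole optimal face get $m_g = 1$; the others tend to infinity with
  $B$ near a relatively interior point of the face, which is what the sieve requires.
\<close>

subsection \<open>The optimal face of the linear program\<close>

lemma lookup_scaleR: "Poly_Mapping.lookup (r *\<^sub>R x) k = r *\<^sub>R Poly_Mapping.lookup x k"
proof -
  have "finite {i. r *\<^sub>R Poly_Mapping.lookup x i \<noteq> 0}"
    by (rule finite_subset[OF _ finite_keys[of x]]) (auto simp: in_keys_iff)
  then show ?thesis
    by (simp add: scaleR_poly_mapping_def lookup_Abs_poly_mapping)
qed

lemma finite_Tset:
  assumes "n \<ge> 1" "\<forall>i\<le>n. q i > 0"
  shows "finite (Tset n q)"
proof -
  define L where "L = (LCM j\<in>{0..n}. q j)"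
  have L: "L > 0" "\<And>i. i \<le> n \<Longrightarrow> cofactor n q i dvd L"
  proof -
    have "finite (q ` {0..n})" "0 \<notin> q ` {0..n}" using assms(2) by auto
    then show "L > 0" unfolding L_def by (metis Lcm_0_iff_nat bot_nat_0.not_eq_extremum)
    fix i assume "i \<le> n"
    then have "q i dvd L" unfolding L_def by (intro dvd_Lcm) auto
    then show "cofactor n q i dvd L"
      unfolding cofactor_def L_def[symmetric] by (metis dvd_def dvd_div_mult_self)
  qed
  \<comment> \<open>The vectors \<open>L e\<^sub>i\<close> lie in \<open>M\<close>, so no minimal element has a coordinate above \<open>L\<close>.\<close>
  define u where "u i = (\<lambda>j. if j = i then L else 0)" for i :: nat
  have u: "u i \<in> Mset n q - {\<lambda>_. 0}" if "i \<le> n" for i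
  proof -
    have "(MIN j\<in>{0..n}. u i j) = 0"
    proof -
      obtain k where "k \<le> n" "k \<noteq> i" using assms(1) by (metis le0 le_zero_eq not_one_le_zero)
      then have "0 \<in> u i ` {0..n}" unfolding u_def by force
      then show ?thesis by (metis Min_le finite_atLeastAtMost finite_imageI le_zero_eq)
    qed
    moreover have "[u i j = u i k] (mod gcd (cofactor n q j) (cofactor n q k))" if "j \<le> n" "k \<le> n" for j k
    proof -
      have "gcd (cofactor n q j) (cofactor n q k) dvd L" using L(2) that by (meson dvd_trans gcd_dvd1)
      then show ?thesis unfolding u_def by (auto simp: cong_0_iff cong_sym_eq[of 0])
    qed
    moreover have "u i \<noteq> (\<lambda>_. 0)" using L(1) by (auto simp: u_def fun_eq_iff)
    ultimately show ?thesis using that by (auto simp: Mset_def u_def)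
  qed
  have "Tset n q \<subseteq> {g. \<forall>i. (i \<in> {0..n} \<longrightarrow> g i \<in> {0..L}) \<and> (i \<notin> {0..n} \<longrightarrow> g i = 0)}"
  proof
    fix g assume g: "g \<in> Tset n q"
    have "g i \<le> L" if "i \<le> n" for i
    proof (rule ccontr)
      assume "\<not> g i \<le> L"
      then have "u i \<le> g" by (auto simp: u_def le_fun_def)
      then have "u i = g" using g u[OF that] by (auto simp: Tset_def)
      then show False using \<open>\<not> g i \<le> L\<close> by (auto simp: u_def)
    qed
    moreover have "g i = 0" if "i > n" for i using g that by (auto simp: Tset_def Mset_def)
    ultimately show "g \<in> {g. \<forall>i. (i \<in> {0..n} \<longrightarrow> g i \<in> {0..L}) \<and> (i \<notin> {0..n} \<longrightarrow> g i = 0)}" by auto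
  qed
  moreover have "finite {g. \<forall>i. (i \<in> {0..n} \<longrightarrow> g i \<in> {0..L}) \<and> (i \<notin> {0..n} \<longrightarrow> g i = 0)}"
    by (rule finite_set_of_finite_funs) auto
  ultimately show ?thesis by (rule finite_subset)
qed

lemma Tset_ge_1:
  assumes "g \<in> Tset n q"
  obtains i where "i \<le> n" "g i \<ge> 1"
proof -
  have "g \<noteq> (\<lambda>_. 0)" "\<forall>i>n. g i = 0" using assms by (auto simp: Tset_def Mset_def)
  then obtain i where "g i \<noteq> 0" by auto
  with \<open>\<forall>i>n. g i = 0\<close> have "i \<le> n" by (meson not_le)
  then show ?thesis using that \<open>g i \<noteq> 0\<close> by simp
qed

lemma lp_optimal_face_nonempty:
  assumes "finite (Tset n q)"
  shows "lp_optimal_face n q \<noteq> {}"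
proof -
  define T where "T = Tset n q"
  define K where "K = PiE UNIV (\<lambda>g. if g \<in> T then {0..1::real} else {0})"
  define A where "A = K \<inter> (\<Inter>i\<in>{..n}. {f. (\<Sum>g\<in>T. f g * real (g i)) \<le> 1})"
  have fin: "finite T" using assms by (simp add: T_def)
  have "compactin (product_topology (\<lambda>_. euclidean) UNIV) K"
    unfolding K_def by (subst compactin_PiE) auto
  then have "compact K" by (simp add: euclidean_product_topology)
  have cont: "continuous_on UNIV (\<lambda>f::(nat \<Rightarrow> nat) \<Rightarrow> real. \<Sum>g\<in>T. f g * h g)" for h
    by (intro continuous_intros continuous_on_product_coordinates)
  have "closed {f::(nat \<Rightarrow> nat) \<Rightarrow> real. (\<Sum>g\<in>T. f g * real (g i)) \<le> 1}" for i
    by (intro closed_Collect_le continuous_on_const cont)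
  then have "closed (\<Inter>i\<in>{..n}. {f::(nat \<Rightarrow> nat) \<Rightarrow> real. (\<Sum>g\<in>T. f g * real (g i)) \<le> 1})" by blast
  with \<open>compact K\<close> have "compact A" unfolding A_def by (rule compact_Int_closed)
  moreover have "(\<lambda>_. 0) \<in> A" by (auto simp: A_def K_def)
  moreover have "continuous_on A (\<lambda>f. \<Sum>g\<in>T. f g)"
    using cont[of "\<lambda>_. 1"] by (auto intro: continuous_on_subset)
  ultimately obtain f where f: "f \<in> A" "\<And>f'. f' \<in> A \<Longrightarrow> (\<Sum>g\<in>T. f' g) \<le> (\<Sum>g\<in>T. f g)"
    using continuous_attains_sup[of A "\<lambda>f. \<Sum>g\<in>T. f g"] by blast
  have f0: "f g = 0" if "g \<notin> T" for g using f(1) that by (auto simp: A_def K_def PiE_def Pi_def split: if_splits)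
  have f1: "f g \<ge> 0" if "g \<in> T" for g using f(1) that by (auto simp: A_def K_def PiE_def Pi_def split: if_splits)
  define c where "c = Abs_poly_mapping f"
  have c: "Poly_Mapping.lookup c = f" unfolding c_def
    by (rule lookup_Abs_poly_mapping) (rule finite_subset[OF _ fin], use f0 in auto)
  have "c \<in> lp_feasible n q" using f(1) f0 f1
    unfolding lp_feasible_def c T_def[symmetric] using c by (auto simp: in_keys_iff A_def)
  moreover have le: "lp_objective n q d \<le> lp_objective n q c" if d: "d \<in> lp_feasible n q" for d
  proof -
    have "Poly_Mapping.lookup d g \<le> 1" if g: "g \<in> T" for g
    proof -
      obtain i where i: "i \<le> n" "g i \<ge> 1" using Tset_ge_1[of g n q] g unfolding T_def by blast
      have "Poly_Mapping.lookup d g * 1 \<le> Poly_Mapping.lookup d g * real (g i)"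
        using i d g by (intro mult_left_mono) (auto simp: lp_feasible_def T_def)
      also have "\<dots> \<le> (\<Sum>g\<in>T. Poly_Mapping.lookup d g * real (g i))"
        using d g fin by (intro member_le_sum) (auto simp: lp_feasible_def T_def)
      also have "\<dots> \<le> 1" using d i by (auto simp: lp_feasible_def T_def)
      finally show ?thesis by simp
    qed
    then have "Poly_Mapping.lookup d \<in> A"
      using d by (auto simp: A_def K_def lp_feasible_def T_def in_keys_iff subset_iff)
    from f(2)[OF this] show ?thesis by (simp add: lp_objective_def c T_def)
  qed
  ultimately have "lp_value n q = lp_objective n q c"
    unfolding lp_value_def by (intro cSup_eq_maximum) auto
  with \<open>c \<in> lp_feasible n q\<close> show ?thesis by (auto simp: lp_optimal_face_def)
qed

lemma lp_optimal_faceD: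
  assumes "c \<in> lp_optimal_face n q"
  shows "\<And>g. g \<notin> Tset n q \<Longrightarrow> Poly_Mapping.lookup c g = 0"
    and "\<And>g. Poly_Mapping.lookup c g \<ge> 0"
    and "\<And>i. i \<le> n \<Longrightarrow> (\<Sum>g \<in> Tset n q. Poly_Mapping.lookup c g * real (g i)) \<le> 1"
    and "(\<Sum>g \<in> Tset n q. Poly_Mapping.lookup c g) = lp_value n q"
proof -
  have 0: "Poly_Mapping.lookup c g = 0" if "g \<notin> Tset n q" for g
    using assms that by (auto simp: lp_optimal_face_def lp_feasible_def in_keys_iff subset_iff)
  fix g
  show "g \<notin> Tset n q \<Longrightarrow> Poly_Mapping.lookup c g = 0" by (rule 0)
  show "Poly_Mapping.lookup c g \<ge> 0" using assms 0[of g]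
    by (cases "g \<in> Tset n q") (auto simp: lp_optimal_face_def lp_feasible_def)
qed (use assms in \<open>auto simp: lp_optimal_face_def lp_feasible_def lp_objective_def\<close>)

lemma convex_lp_optimal_face: "convex (lp_optimal_face n q)"
proof (rule convexI)
  fix c d u v assume c: "c \<in> lp_optimal_face n q" and d: "d \<in> lp_optimal_face n q"
    and uv: "0 \<le> u" "0 \<le> v" "u + v = (1::real)"
  let ?e = "u *\<^sub>R c + v *\<^sub>R d"
  have l: "Poly_Mapping.lookup ?e g = u * Poly_Mapping.lookup c g + v * Poly_Mapping.lookup d g" for g
    by (simp add: lookup_add lookup_scaleR)
  note c' = lp_optimal_faceD[OF c] and d' = lp_optimal_faceD[OF d]
  have s: "(\<Sum>g \<in> Tset n q. Poly_Mapping.lookup ?e g * h g) =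
     u * (\<Sum>g \<in> Tset n q. Poly_Mapping.lookup c g * h g) + v * (\<Sum>g \<in> Tset n q. Poly_Mapping.lookup d g * h g)" for h
    unfolding l by (simp add: sum_distrib_left sum.distrib algebra_simps)
  have "(\<Sum>g \<in> Tset n q. Poly_Mapping.lookup ?e g * real (g i)) \<le> 1" if "i \<le> n" for i
    unfolding s using convex_bound_le[OF c'(3)[OF that] d'(3)[OF that] uv] .
  moreover have "lp_objective n q ?e = lp_value n q"
    using s[of "\<lambda>_. 1"] c'(4) d'(4) uv by (simp add: lp_objective_def flip: distrib_right)
  moreover have "Poly_Mapping.lookup ?e g \<ge> 0" for g using c'(2) d'(2) uv by (simp add: l)
  moreover have "Poly_Mapping.keys ?e \<subseteq> Tset n q"
  proof
    fix g assume "g \<in> Poly_Mapping.keys ?e"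
    then have "Poly_Mapping.lookup ?e g \<noteq> 0" by (simp add: in_keys_iff)
    then show "g \<in> Tset n q" using c'(1)[of g] d'(1)[of g] by (cases "g \<in> Tset n q") (auto simp: l)
  qed
  ultimately show "?e \<in> lp_optimal_face n q"
    by (auto simp: lp_optimal_face_def lp_feasible_def)
qed

lemma span_differences_convex:
  fixes F :: "'a::real_vector set"
  assumes F: "convex F" "F \<noteq> {}" and w: "w \<in> span {c - d |c d. c \<in> F \<and> d \<in> F}"
  obtains r c d where "r > 0" "c \<in> F" "d \<in> F" "w = r *\<^sub>R (c - d)"
proof -
  have "\<exists>r c d. r > 0 \<and> c \<in> F \<and> d \<in> F \<and> w = r *\<^sub>R (c - d)"
    using w
  proof (induction rule: span_induct_alt)
    case base
    then show ?case using F(2) by (metis all_not_in_conv diff_self scaleR_zero_right zero_less_one)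
  next
    case (step k x y)
    then obtain c d r c' d' where *: "c \<in> F" "d \<in> F" "x = c - d" "r > 0" "c' \<in> F" "d' \<in> F" "y = r *\<^sub>R (c' - d')"
      by blast
    define c1 where "c1 = (if k \<ge> 0 then c else d)"
    define d1 where "d1 = (if k \<ge> 0 then d else c)"
    have 1: "k *\<^sub>R x = \<bar>k\<bar> *\<^sub>R (c1 - d1)" "c1 \<in> F" "d1 \<in> F"
      using * by (auto simp: c1_def d1_def algebra_simps)
    define s where "s = \<bar>k\<bar> + r"
    have s: "s > 0" using *(4) by (simp add: s_def)
    have conv: "(\<bar>k\<bar> / s) *\<^sub>R a + (r / s) *\<^sub>R b \<in> F" if "a \<in> F" "b \<in> F" for a b
    proof (intro convexD[OF F(1)] that)
      show "\<bar>k\<bar> / s + r / s = 1" using s by (simp add: s_def flip: add_divide_distrib)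
    qed (use s *(4) in auto)
    have "k *\<^sub>R x + y = s *\<^sub>R (((\<bar>k\<bar> / s) *\<^sub>R c1 + (r / s) *\<^sub>R c') - ((\<bar>k\<bar> / s) *\<^sub>R d1 + (r / s) *\<^sub>R d'))"
      using s unfolding 1(1) *(7) by (simp add: algebra_simps)
    then show ?case using s conv 1 * by blast
  qed
  then show ?thesis using that by blast
qed

text \<open>
  A reduced echelon basis of the direction space: moving by integer multiples of its vectors moves
  the pivot coordinates by integers, which keeps the rounded points distinct.
\<close>
lemma dual_coordinates:
  fixes V :: "('a \<Rightarrow>\<^sub>0 real) set"
  assumes V: "subspace V" and T: "finite T" and keys: "\<And>v. v \<in> V \<Longrightarrow> Poly_Mapping.keys v \<subseteq> T"
  shows "\<exists>J w. J \<subseteq> T \<and> dim V \<le> card J \<and> (\<forall>j\<in>J. w j \<in> V) \<and>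
    (\<forall>i\<in>J. \<forall>j\<in>J. Poly_Mapping.lookup (w j) i = (if i = j then 1 else 0))"
proof -
  define dual where "dual J w \<longleftrightarrow> (\<forall>j\<in>J. w j \<in> V) \<and>
    (\<forall>i\<in>J. \<forall>j\<in>J. Poly_Mapping.lookup (w j) i = (if i = j then 1 else 0))" for J and w :: "'a \<Rightarrow> 'a \<Rightarrow>\<^sub>0 real"
  define \<J> where "\<J> = {J. J \<subseteq> T \<and> (\<exists>w. dual J w)}"
  have "finite \<J>" by (rule finite_subset[of _ "Pow T"]) (auto simp: \<J>_def T)
  moreover have "{} \<in> \<J>" by (auto simp: \<J>_def dual_def)
  ultimately obtain J where J: "J \<in> \<J>" and max: "\<And>J'. J' \<in> \<J> \<Longrightarrow> J \<subseteq> J' \<Longrightarrow> J = J'"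
    using finite_has_maximal[of \<J>] by blast
  then obtain w where "dual J w" by (auto simp: \<J>_def)
  then have wV: "\<And>j. j \<in> J \<Longrightarrow> w j \<in> V"
    and w: "\<And>i j. i \<in> J \<Longrightarrow> j \<in> J \<Longrightarrow> Poly_Mapping.lookup (w j) i = (if i = j then 1 else 0)"
    by (auto simp: dual_def)
  have JT: "J \<subseteq> T" and finJ: "finite J" using J T finite_subset by (auto simp: \<J>_def)
  have "V \<subseteq> span (w ` J)"
  proof
    fix v assume v: "v \<in> V"
    define v' where "v' = v - (\<Sum>j\<in>J. Poly_Mapping.lookup v j *\<^sub>R w j)"
    have v'V: "v' \<in> V" unfolding v'_def
      by (intro subspace_diff subspace_sum subspace_mul V v wV)
    have v'J: "Poly_Mapping.lookup v' i = 0" if "i \<in> J" for i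
    proof -
      have "(\<Sum>j\<in>J. Poly_Mapping.lookup v j * Poly_Mapping.lookup (w j) i) = (\<Sum>j\<in>J. if i = j then Poly_Mapping.lookup v j else 0)"
        by (rule sum.cong) (use w that in auto)
      also have "\<dots> = Poly_Mapping.lookup v i" using finJ that by simp
      finally show ?thesis by (simp add: v'_def lookup_minus lookup_sum lookup_scaleR)
    qed
    have "v' = 0"
    proof (rule ccontr)
      assume "v' \<noteq> 0"
      then obtain h where h: "Poly_Mapping.lookup v' h \<noteq> 0" by (metis lookup_zero poly_mapping_eqI)
      then have hJ: "h \<notin> J" using v'J by blast
      have "h \<in> T" using keys[OF v'V] h by (auto simp: in_keys_iff)
      define u where "u = (1 / Poly_Mapping.lookup v' h) *\<^sub>R v'"
      have u: "u \<in> V" "Poly_Mapping.lookup u h = 1" "\<And>i. i \<in> J \<Longrightarrow> Poly_Mapping.lookup u i = 0"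
        using h v'J by (auto simp: u_def lookup_scaleR intro: subspace_mul V v'V)
      define w' where "w' j = (if j = h then u else w j - Poly_Mapping.lookup (w j) h *\<^sub>R u)" for j
      have "w' j \<in> V" if "j \<in> insert h J" for j
        using that u wV by (auto simp: w'_def intro!: subspace_diff subspace_mul V)
      moreover have "Poly_Mapping.lookup (w' j) i = (if i = j then 1 else 0)"
        if "i \<in> insert h J" "j \<in> insert h J" for i j
        using that u(2,3) w hJ by (auto simp: w'_def lookup_minus lookup_scaleR)
      ultimately have "dual (insert h J) w'" unfolding dual_def by blast
      then have "insert h J \<in> \<J>" using JT \<open>h \<in> T\<close> unfolding \<J>_def by blast
      then show False using max hJ by blast
    qed
    then have "v = (\<Sum>j\<in>J. Poly_Mapping.lookup v j *\<^sub>R w j)" by (simp add: v'_def)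
    then show "v \<in> span (w ` J)" by (metis (no_types, lifting) imageI span_base span_scale span_sum)
  qed
  then have "dim V \<le> card (w ` J)" using finJ by (intro dim_le_card) auto
  also have "\<dots> \<le> card J" by (rule card_image_le[OF finJ])
  finally show ?thesis using JT wV w by (intro exI[of _ J] exI[of _ w]) auto
qed

lemma convex_average_perturb:
  fixes F :: "'a::real_vector set"
  assumes F: "convex F" and P: "finite P" "P \<subseteq> F" "a \<in> P" "b \<in> P" and t: "0 \<le> t" "t \<le> 1 / real (card P)"
  shows "(\<Sum>p\<in>P. (1 / real (card P)) *\<^sub>R p) + t *\<^sub>R (a - b) \<in> F"
proof -
  define coef where "coef x = 1 / real (card P) + (if x = a then t else 0) - (if x = b then t else 0)" for x
  have "card P > 0" using P(1,3) card_gt_0_iff by blast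
  have "(\<Sum>x\<in>P. coef x *\<^sub>R x) \<in> F"
  proof (rule convex_sum[OF P(1) F])
    show "(\<Sum>x\<in>P. coef x) = 1" using P(1,3,4) \<open>card P > 0\<close> by (auto simp: coef_def sum.distrib sum_subtractf)
  qed (use t P in \<open>auto simp: coef_def\<close>)
  also have "(\<Sum>x\<in>P. coef x *\<^sub>R x) = (\<Sum>p\<in>P. (1 / real (card P)) *\<^sub>R p) +
     (\<Sum>x\<in>P. if x = a then t *\<^sub>R a else 0) - (\<Sum>x\<in>P. if x = b then t *\<^sub>R b else 0)"
    unfolding sum.distrib[symmetric] sum_subtractf[symmetric]
    by (rule sum.cong) (auto simp: coef_def algebra_simps)
  also have "\<dots> = (\<Sum>p\<in>P. (1 / real (card P)) *\<^sub>R p) + t *\<^sub>R (a - b)"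
    using P by (simp add: algebra_simps)
  finally show ?thesis .
qed

lemma convex_sum_perturb:
  fixes F :: "'a::real_vector set"
  assumes F: "convex F" "c \<in> F" and J: "finite J" and t: "\<And>j. j \<in> J \<Longrightarrow> c + (real (card J) * t j) *\<^sub>R w j \<in> F"
  shows "c + (\<Sum>j\<in>J. t j *\<^sub>R w j) \<in> F"
proof (cases "J = {}")
  case False
  then have c0: "card J > 0" using J by (simp add: card_gt_0_iff)
  have "(\<Sum>j\<in>J. (1 / real (card J)) *\<^sub>R (c + (real (card J) * t j) *\<^sub>R w j)) \<in> F"
    using c0 t by (intro convex_sum J F) auto
  also have "(\<Sum>j\<in>J. (1 / real (card J)) *\<^sub>R (c + (real (card J) * t j) *\<^sub>R w j))
     = (\<Sum>j\<in>J. (1 / real (card J)) *\<^sub>R c + t j *\<^sub>R w j)"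
    using c0 by (intro sum.cong) (auto simp: algebra_simps)
  also have "\<dots> = c + (\<Sum>j\<in>J. t j *\<^sub>R w j)"
    using c0 by (simp add: sum.distrib sum_constant_scaleR)
  finally show ?thesis .
qed (use F in simp)

lemma lp_lattice_points:
  assumes fin: "finite (Tset n q)"
  shows "\<exists>S \<delta> \<eta>. S \<subseteq> Tset n q \<and> (\<delta>::real) > 0 \<and> (\<eta>::real) > 0 \<and>
    (\<forall>\<mu>>0. \<exists>E \<subseteq> PiE S (\<lambda>_. UNIV :: nat set). finite E \<and> (\<eta> * \<mu>) ^ lp_face_dim n q \<le> real (card E) \<and>
       (\<forall>e\<in>E. (\<forall>g\<in>S. \<delta> * \<mu> - 1 \<le> real (e g)) \<and>
          (\<forall>i\<le>n. (\<Sum>g\<in>S. real (e g) * real (g i)) \<le> \<mu>) \<and>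
          lp_value n q * \<mu> - real (card S) \<le> (\<Sum>g\<in>S. real (e g))))"
proof -
  define T where "T = Tset n q"
  define F where "F = lp_optimal_face n q"
  define V where "V = span {c - d |c d. c \<in> F \<and> d \<in> F}"
  have finT: "finite T" using fin by (simp add: T_def)
  have F: "convex F" "F \<noteq> {}"
    using convex_lp_optimal_face lp_optimal_face_nonempty[OF fin] by (auto simp: F_def)
  note FD = lp_optimal_faceD[where n = n and q = q, folded F_def T_def]
  obtain c0 where c0: "c0 \<in> F" using F(2) by blast
  have dimV: "dim V = lp_face_dim n q" by (simp add: V_def lp_face_dim_def F_def dim_span)
  have VD: "\<exists>r c d. r > 0 \<and> c \<in> F \<and> d \<in> F \<and> v = r *\<^sub>R (c - d)" if "v \<in> V" for v
    using span_differences_convex[OF F that[unfolded V_def]] by metis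
  have keysV: "Poly_Mapping.keys v \<subseteq> T" if v: "v \<in> V" for v
  proof
    fix g assume g: "g \<in> Poly_Mapping.keys v"
    obtain r c d where "c \<in> F" "d \<in> F" "v = r *\<^sub>R (c - d)" using VD[OF v] by blast
    then show "g \<in> T" using g FD(1)[of c g] FD(1)[of d g]
      by (cases "g \<in> T") (auto simp: in_keys_iff lookup_scaleR lookup_minus)
  qed
  have subV: "subspace V" by (simp add: V_def)
  obtain J w where JT: "J \<subseteq> T" and dimJ: "dim V \<le> card J" and wV: "\<And>j. j \<in> J \<Longrightarrow> w j \<in> V"
    and w: "\<And>i j. i \<in> J \<Longrightarrow> j \<in> J \<Longrightarrow> Poly_Mapping.lookup (w j) i = (if i = j then 1 else 0)"
    using dual_coordinates[OF subV finT keysV] by blast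
  have finJ: "finite J" using JT finT finite_subset by blast
  have "\<forall>j\<in>J. \<exists>r c d. r > 0 \<and> c \<in> F \<and> d \<in> F \<and> w j = r *\<^sub>R (c - d)" using VD wV by blast
  then obtain r a b where rab: "\<And>j. j \<in> J \<Longrightarrow> r j > 0" "\<And>j. j \<in> J \<Longrightarrow> a j \<in> F" "\<And>j. j \<in> J \<Longrightarrow> b j \<in> F"
    "\<And>j. j \<in> J \<Longrightarrow> w j = r j *\<^sub>R (a j - b j)" by metis
  have "\<forall>g. \<exists>c\<in>F. (\<exists>c'\<in>F. Poly_Mapping.lookup c' g > 0) \<longrightarrow> Poly_Mapping.lookup c g > 0"
    using c0 by blast
  then obtain p where p: "\<And>g. p g \<in> F" "\<And>g c'. c' \<in> F \<Longrightarrow> Poly_Mapping.lookup c' g > 0 \<Longrightarrow> Poly_Mapping.lookup (p g) g > 0"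
    by metis
  define P where "P = insert c0 (a ` J \<union> b ` J \<union> p ` T)"
  have P: "finite P" "P \<subseteq> F" "c0 \<in> P" using finJ finT c0 rab p by (auto simp: P_def)
  define M where "M = real (card P)"
  have M: "M > 0" using P by (auto simp: M_def card_gt_0_iff)
  define cs where "cs = (\<Sum>x\<in>P. (1 / M) *\<^sub>R x)"
  have perturb: "cs + t *\<^sub>R (x - y) \<in> F" if "x \<in> P" "y \<in> P" "0 \<le> t" "t \<le> 1 / M" for x y t
    using convex_average_perturb[OF F(1) P(1,2) that(1,2)] that(3,4) by (simp add: cs_def M_def)
  have csF: "cs \<in> F" using perturb[OF P(3) P(3), of 0] M by simp
  define S where "S = {g \<in> T. Poly_Mapping.lookup cs g > 0}"
  have S: "S \<subseteq> T" "finite S" using finT by (auto simp: S_def)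
  have vanish: "Poly_Mapping.lookup x g = 0" if x: "x \<in> F" and g: "g \<notin> S" for x g
  proof (cases "g \<in> T")
    case True
    have "\<not> Poly_Mapping.lookup x g > 0"
    proof
      assume "Poly_Mapping.lookup x g > 0"
      then have "0 < (1 / M) * Poly_Mapping.lookup (p g) g" using p(2)[OF x] M by simp
      also have "\<dots> \<le> (\<Sum>x\<in>P. (1 / M) * Poly_Mapping.lookup x g)"
        using P True M FD(2) by (intro member_le_sum) (auto simp: P_def intro!: mult_nonneg_nonneg)
      also have "\<dots> = Poly_Mapping.lookup cs g" by (simp add: cs_def lookup_sum lookup_scaleR)
      finally show False using g True by (simp add: S_def)
    qed
    then show ?thesis using FD(2)[OF x, of g] by simp
  qed (use FD(1)[OF x] in auto)
  have JS: "J \<subseteq> S"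
  proof
    fix j assume j: "j \<in> J"
    show "j \<in> S"
    proof (rule ccontr)
      assume "j \<notin> S"
      then have "Poly_Mapping.lookup (w j) j = 0"
        using rab[OF j] vanish by (simp add: lookup_scaleR lookup_minus)
      then show False using w j by simp
    qed
  qed
  define R where "R = (\<Sum>j\<in>J. r j) + 1"
  have R: "R \<ge> 1" "\<And>j. j \<in> J \<Longrightarrow> r j \<le> R"
    using rab(1) finJ member_le_sum[of _ J r] by (force simp: R_def less_imp_le intro: sum_nonneg)+
  define \<epsilon> where "\<epsilon> = 1 / (2 * M * R * (real (card J) + 1))"
  have \<epsilon>: "\<epsilon> > 0" using M R by (simp add: \<epsilon>_def)
  have inF: "cs + (\<Sum>j\<in>J. t j *\<^sub>R w j) \<in> F" if t: "\<And>j. j \<in> J \<Longrightarrow> 0 \<le> t j \<and> t j \<le> 2 * \<epsilon>" for t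
  proof (rule convex_sum_perturb[OF F(1) csF finJ])
    fix j assume j: "j \<in> J"
    have "real (card J) * t j * r j \<le> (real (card J) + 1) * (2 * \<epsilon>) * R"
      using t[OF j] R(2)[OF j] rab(1)[OF j] \<epsilon> by (intro mult_mono) auto
    also have "\<dots> = 1 / M" using M R by (simp add: \<epsilon>_def)
    finally have "cs + (real (card J) * t j * r j) *\<^sub>R (a j - b j) \<in> F"
      using t[OF j] rab(1)[OF j] j by (intro perturb) (auto simp: P_def)
    then show "cs + (real (card J) * t j) *\<^sub>R w j \<in> F" using rab(4)[OF j] by simp
  qed
  define \<delta> where "\<delta> = Min (insert 1 (Poly_Mapping.lookup cs ` S)) / 2"
  have \<delta>: "\<delta> > 0" "\<And>g. g \<in> S \<Longrightarrow> 2 * \<delta> \<le> Poly_Mapping.lookup cs g"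
    using S(2) by (auto simp: \<delta>_def S_def)
  have main: "\<exists>E \<subseteq> PiE S (\<lambda>_. UNIV :: nat set). finite E \<and> (\<epsilon> * \<mu>) ^ lp_face_dim n q \<le> real (card E) \<and>
       (\<forall>e\<in>E. (\<forall>g\<in>S. \<delta> * \<mu> - 1 \<le> real (e g)) \<and>
          (\<forall>i\<le>n. (\<Sum>g\<in>S. real (e g) * real (g i)) \<le> \<mu>) \<and>
          lp_value n q * \<mu> - real (card S) \<le> (\<Sum>g\<in>S. real (e g)))" if \<mu>: "\<mu> > 0" for \<mu>
  proof -
    define Z where "Z = nat \<lfloor>\<epsilon> * \<mu>\<rfloor>"
    define x where "x z = cs + (\<Sum>j\<in>J. (real (z j) / \<mu>) *\<^sub>R w j)" for z :: "(nat \<Rightarrow> nat) \<Rightarrow> nat"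
    define e where "e z = restrict (\<lambda>g. nat \<lfloor>\<mu> * Poly_Mapping.lookup (x z) g\<rfloor>) S" for z
    define D where "D = PiE J (\<lambda>_. {0..Z})"
    have zb: "0 \<le> 2 * (real (z j) / \<mu>) \<and> 2 * (real (z j) / \<mu>) \<le> 2 * \<epsilon>" if "z \<in> D" "j \<in> J" for z j
    proof -
      have "z j \<le> Z" using that by (auto simp: D_def PiE_def Pi_def)
      then have "real (z j) \<le> \<epsilon> * \<mu>" using \<epsilon> \<mu> by (simp add: Z_def le_nat_iff le_floor_iff)
      then show ?thesis using \<mu> by (simp add: field_simps)
    qed
    have xF: "x z \<in> F" if "z \<in> D" for z
      unfolding x_def using zb[OF that] by (intro inF) fastforce
    \<comment> \<open>\<open>x z\<close> is the midpoint of \<open>cs\<close> and another point of the face.\<close>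
    have xlow: "\<delta> \<le> Poly_Mapping.lookup (x z) g" if z: "z \<in> D" and g: "g \<in> S" for z g
    proof -
      define y where "y = cs + (\<Sum>j\<in>J. (2 * (real (z j) / \<mu>)) *\<^sub>R w j)"
      have "y \<in> F" unfolding y_def using zb[OF z] by (intro inF)
      then have "Poly_Mapping.lookup y g \<ge> 0" by (rule FD(2))
      moreover have "2 * Poly_Mapping.lookup (x z) g = Poly_Mapping.lookup cs g + Poly_Mapping.lookup y g"
        by (simp add: x_def y_def lookup_add lookup_sum lookup_scaleR sum_distrib_left mult.assoc)
      ultimately show ?thesis using \<delta>(2)[OF g] by simp
    qed
    have eval: "real (e z g) \<le> \<mu> * Poly_Mapping.lookup (x z) g" "\<mu> * Poly_Mapping.lookup (x z) g - 1 \<le> real (e z g)"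
      if "z \<in> D" "g \<in> S" for z g
    proof -
      have "\<mu> * Poly_Mapping.lookup (x z) g \<ge> 0" using FD(2)[OF xF[OF that(1)]] \<mu> by simp
      then show "real (e z g) \<le> \<mu> * Poly_Mapping.lookup (x z) g" "\<mu> * Poly_Mapping.lookup (x z) g - 1 \<le> real (e z g)"
        using that(2) by (simp_all add: e_def)
    qed
    have inj: "inj_on e D"
    proof (rule inj_onI)
      fix z z' assume z: "z \<in> D" "z' \<in> D" "e z = e z'"
      have "z j = z' j" if j: "j \<in> J" for j
      proof -
        have lk: "\<lfloor>\<mu> * Poly_Mapping.lookup (x z) j\<rfloor> = \<lfloor>\<mu> * Poly_Mapping.lookup cs j\<rfloor> + int (z j)" for z
        proof -
          have "(\<Sum>i\<in>J. real (z i) / \<mu> * Poly_Mapping.lookup (w i) j) = (\<Sum>i\<in>J. if j = i then real (z i) / \<mu> else 0)"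
            by (rule sum.cong) (use w j in auto)
          also have "\<dots> = real (z j) / \<mu>" using finJ j by simp
          finally have "\<mu> * Poly_Mapping.lookup (x z) j = \<mu> * Poly_Mapping.lookup cs j + of_int (int (z j))"
            using \<mu> by (simp add: x_def lookup_add lookup_sum lookup_scaleR distrib_left)
          then show ?thesis by (simp only: floor_add_int)
        qed
        have "0 \<le> \<lfloor>\<mu> * Poly_Mapping.lookup (x z) j\<rfloor>" "0 \<le> \<lfloor>\<mu> * Poly_Mapping.lookup (x z') j\<rfloor>"
          using FD(2)[OF xF[OF z(1)]] FD(2)[OF xF[OF z(2)]] \<mu> by auto
        moreover have "nat \<lfloor>\<mu> * Poly_Mapping.lookup (x z) j\<rfloor> = nat \<lfloor>\<mu> * Poly_Mapping.lookup (x z') j\<rfloor>"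
          using fun_cong[OF z(3), of j] subsetD[OF JS j] by (simp add: e_def)
        ultimately have "\<lfloor>\<mu> * Poly_Mapping.lookup (x z) j\<rfloor> = \<lfloor>\<mu> * Poly_Mapping.lookup (x z') j\<rfloor>"
          by (simp only: eq_nat_nat_iff)
        then show ?thesis using lk[of z] lk[of z'] by simp
      qed
      then show "z = z'" using z(1,2) unfolding D_def by (intro PiE_ext)
    qed
    have finD: "finite D" unfolding D_def by (intro finite_PiE finJ) auto
    have "(\<epsilon> * \<mu>) ^ lp_face_dim n q \<le> real (card (e ` D))"
    proof -
      have c: "real (card (e ` D)) = (real Z + 1) ^ card J"
        unfolding card_image[OF inj] using finJ by (simp add: D_def card_PiE add.commute)
      have le: "\<epsilon> * \<mu> \<le> real Z + 1" using \<epsilon> \<mu> unfolding Z_def by linarith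
      have "(\<epsilon> * \<mu>) ^ lp_face_dim n q \<le> (real Z + 1) ^ lp_face_dim n q"
        using le \<epsilon> \<mu> by (intro power_mono) auto
      also have "\<dots> \<le> (real Z + 1) ^ card J"
        using dimJ dimV by (intro power_increasing) auto
      finally show ?thesis using c by simp
    qed
    moreover have "\<delta> * \<mu> - 1 \<le> real (e z g)" if "z \<in> D" "g \<in> S" for z g
    proof -
      have "\<mu> * \<delta> \<le> \<mu> * Poly_Mapping.lookup (x z) g" using xlow[OF that] \<mu> by simp
      then show ?thesis using eval(2)[OF that] by (simp add: mult.commute)
    qed
    moreover have "(\<Sum>g\<in>S. real (e z g) * real (g i)) \<le> \<mu>" if z: "z \<in> D" and i: "i \<le> n" for z i
    proof -
      have "(\<Sum>g\<in>S. real (e z g) * real (g i)) \<le> (\<Sum>g\<in>S. \<mu> * (Poly_Mapping.lookup (x z) g * real (g i)))"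
        unfolding mult.assoc[symmetric] by (intro sum_mono mult_right_mono eval(1) z) auto
      also have "\<dots> \<le> (\<Sum>g\<in>T. \<mu> * (Poly_Mapping.lookup (x z) g * real (g i)))"
        using FD(2)[OF xF[OF z]] \<mu> by (intro sum_mono2 finT S) auto
      also have "\<dots> = \<mu> * (\<Sum>g\<in>T. Poly_Mapping.lookup (x z) g * real (g i))" by (simp add: sum_distrib_left)
      also have "\<dots> \<le> \<mu> * 1" using FD(3)[OF xF[OF z] i] \<mu> by (intro mult_left_mono) auto
      finally show ?thesis by simp
    qed
    moreover have "lp_value n q * \<mu> - real (card S) \<le> (\<Sum>g\<in>S. real (e z g))" if z: "z \<in> D" for z
    proof -
      have "lp_value n q = (\<Sum>g\<in>S. Poly_Mapping.lookup (x z) g)"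
        unfolding FD(4)[OF xF[OF z], symmetric]
        by (rule sum.mono_neutral_right[OF finT S(1)]) (use vanish[OF xF[OF z]] in auto)
      then have "lp_value n q * \<mu> - real (card S) = (\<Sum>g\<in>S. \<mu> * Poly_Mapping.lookup (x z) g - 1)"
        by (simp add: sum_subtractf sum_distrib_left mult.commute)
      also have "\<dots> \<le> (\<Sum>g\<in>S. real (e z g))" by (intro sum_mono eval(2) z)
      finally show ?thesis .
    qed
    ultimately show ?thesis using finD by (intro exI[of _ "e ` D"]) (auto simp: e_def)
  qed
  have "S \<subseteq> Tset n q" using S(1) by (simp add: T_def)
  with \<delta>(1) \<epsilon> main show ?thesis by (intro exI[of _ S] exI[of _ \<delta>] exI[of _ \<epsilon>] conjI allI impI)
qed

subsection \<open>Coprime squarefree tuples in dyadic boxes\<close>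

lemma card_cong_interval_le:
  fixes A :: "nat set" and d a N :: nat
  assumes "d > 0" "A \<subseteq> {a<..a + N}" and cong: "\<And>x y. x \<in> A \<Longrightarrow> y \<in> A \<Longrightarrow> [x = y] (mod d)"
  shows "real (card A) \<le> real N / real d + 1"
proof (cases "A = {}")
  case False
  have fin: "finite A" using assms(2) finite_subset by blast
  define m where "m = Min A"
  have m: "m \<in> A" "\<And>x. x \<in> A \<Longrightarrow> m \<le> x" using fin False by (auto simp: m_def)
  have "inj_on (\<lambda>x. (x - m) div d) A"
  proof (rule inj_onI)
    fix x y assume xy: "x \<in> A" "y \<in> A" "(x - m) div d = (y - m) div d"
    have "d dvd x - m" "d dvd y - m" 
      using cong[OF xy(1) m(1)] cong[OF xy(2) m(1)] m(2)[OF xy(1)] m(2)[OF xy(2)]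
      by (auto simp: cong_altdef_nat)
    then have "x - m = y - m" using xy(3) by (metis dvd_div_mult_self)
    then show "x = y" using m(2)[OF xy(1)] m(2)[OF xy(2)] by simp
  qed
  moreover have "(\<lambda>x. (x - m) div d) ` A \<subseteq> {..N div d}"
  proof (rule image_subsetI)
    fix x assume "x \<in> A"
    then have "x \<le> a + N" "a < m" using assms(2) m(1) by auto
    then have "x - m \<le> N" by simp
    then show "(x - m) div d \<in> {..N div d}" by (simp add: div_le_mono)
  qed
  ultimately have "card A \<le> card {..N div d}" by (metis card_inj_on_le finite_atMost)
  then have "card A \<le> N div d + 1" by simp
  then have "real (card A) \<le> real (N div d) + 1" by linarith
  also have "real (N div d) \<le> real N / real d" by (rule of_nat_div_le_of_nat)
  finally show ?thesis by simp
qed simp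

lemma card_dvd_affine_le:
  fixes W d N :: nat
  assumes "d > 0" "coprime d W"
  shows "real (card {k \<in> {N<..2 * N}. d dvd 1 + W * k}) \<le> real N / real d + 1"
proof (rule card_cong_interval_le[OF assms(1), of _ N])
  fix x y assume "x \<in> {k \<in> {N<..2 * N}. d dvd 1 + W * k}" "y \<in> {k \<in> {N<..2 * N}. d dvd 1 + W * k}"
  then have "[1 + W * x = 0] (mod d)" "[1 + W * y = 0] (mod d)" by (auto simp: cong_0_iff)
  then have "[1 + W * x = 1 + W * y] (mod d)" by (metis cong_sym cong_trans)
  then have "[W * x = W * y] (mod d)" by (subst (asm) cong_add_lcancel_nat)
  then show "[x = y] (mod d)" using assms(2) by (simp add: cong_mult_lcancel_nat coprime_commute)
qed auto

lemma sum_inverse_squares_tail_le: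
  fixes w D :: nat
  assumes "w \<ge> 1"
  shows "(\<Sum>d\<in>{w<..D}. 1 / (real d)^2) \<le> 1 / real w"
proof -
  have "(\<Sum>d\<in>{w<..D}. 1 / (real d)^2) \<le> 1 / real w - 1 / real D" if "D \<ge> w"
    using that
  proof (induction D rule: dec_induct)
    case (step D)
    have D: "real D > 0" using assms step by simp
    have "{w<..Suc D} = insert (Suc D) {w<..D}" using step by auto
    then have "(\<Sum>d\<in>{w<..Suc D}. 1 / (real d)^2) \<le> 1 / (real (Suc D))^2 + (1 / real w - 1 / real D)"
      using step by simp
    moreover have "1 / (real (Suc D))^2 \<le> 1 / (real D * real (Suc D))"
      using D by (intro divide_left_mono) (auto simp: power2_eq_square)
    moreover have "1 / (real D * real (Suc D)) = 1 / real D - 1 / real (Suc D)"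
      using D by (simp add: field_simps)
    ultimately show ?case by simp
  qed simp
  moreover have "1 / real D \<ge> 0" by simp
  ultimately show ?thesis by (cases "D \<ge> w") (linarith, simp)
qed

text \<open>
  Sieving only the progression $1$ modulo $w!$ leaves just primes above $w$, for which the union
  bound over bad primes is small.
\<close>
lemma prime_dvd_Suc_fact_mult:
  fixes p w k :: nat
  assumes "prime p" "p dvd 1 + fact w * k"
  shows "p > w" "coprime p (fact w)"
proof -
  have "\<not> p dvd fact w"
  proof
    assume "p dvd fact w"
    then have "p dvd 1" using assms(2) by (metis dvd_add_left_iff dvd_mult2)
    then show False using assms(1) by auto
  qed
  then show "p > w" using assms(1) by (metis dvd_fact not_le prime_ge_1_nat)
  show "coprime p (fact w)" using assms(1) \<open>\<not> p dvd fact w\<close> by (simp add: prime_imp_coprime)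
qed

lemma Suc_mult_le:
  fixes W k N :: nat
  assumes *: "W \<ge> 1" "k \<le> 2 * N" "N \<ge> 1"
  shows "1 + W * k \<le> 3 * W * N"
proof -
  have "W * k \<le> W * (2 * N)" using *(2) by simp
  moreover have "1 \<le> W * N" using * by simp
  ultimately have "1 + W * k \<le> W * N + W * (2 * N)" by linarith
  then show ?thesis by (simp add: ac_simps)
qed

lemma card_restrict_PiE_le:
  fixes I I' :: "'a \<Rightarrow> nat set" and N :: "'a \<Rightarrow> nat" and \<rho> :: real
  assumes "finite S" "U \<subseteq> S" "\<And>s. s \<in> S \<Longrightarrow> card (I s) = N s"
    and "\<And>s. s \<in> U \<Longrightarrow> real (card (I' s)) \<le> \<rho> * real (N s)"
  shows "real (card (PiE S (\<lambda>s. if s \<in> U then I' s else I s))) \<le> \<rho> ^ card U * (\<Prod>s\<in>S. real (N s))"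
proof -
  have "real (card (PiE S (\<lambda>s. if s \<in> U then I' s else I s)))
      = (\<Prod>s\<in>S. real (card (if s \<in> U then I' s else I s)))"
    using assms(1) by (simp add: card_PiE)
  also have "\<dots> \<le> (\<Prod>s\<in>S. (if s \<in> U then \<rho> else 1) * real (N s))"
    using assms(3,4) by (intro prod_mono) auto
  also have "\<dots> = (\<Prod>s\<in>S. if s \<in> U then \<rho> else 1) * (\<Prod>s\<in>S. real (N s))"
    by (simp add: prod.distrib)
  also have "(\<Prod>s\<in>S. if s \<in> U then \<rho> else 1) = \<rho> ^ card U"
    using assms(1,2) by (simp add: prod.If_cases Int_absorb1)
  finally show ?thesis .
qed

lemma not_squarefree_prime_square:
  fixes m :: nat
  assumes "m > 0" "\<not> squarefree m"
  obtains p where "prime p" "p\<^sup>2 dvd m"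
  using assms squarefree_factorial_semiring[of m] by (auto)

lemma not_coprime_common_prime:
  fixes a b :: nat
  assumes "\<not> coprime a b"
  obtains p where "prime p" "p dvd a" "p dvd b"
  using assms by (metis coprime_iff_gcd_eq_1 gcd_greatest_iff prime_factor_nat)

definition sieve_set :: "'a set \<Rightarrow> nat \<Rightarrow> ('a \<Rightarrow> nat) \<Rightarrow> ('a \<Rightarrow> nat) set" where
  "sieve_set S W N = {k \<in> PiE S (\<lambda>s. {N s<..2 * N s}). (\<forall>s\<in>S. squarefree (1 + W * k s)) \<and>
     (\<forall>s\<in>S. \<forall>t\<in>S. s \<noteq> t \<longrightarrow> coprime (1 + W * k s) (1 + W * k t))}"

lemma half_le_card_sieve_set:
  fixes S :: "'a set"
  assumes S: "finite S"
  shows "\<exists>W\<ge>1. \<exists>N0. \<forall>N. (\<forall>s\<in>S. N s \<ge> N0) \<longrightarrow> (\<Prod>s\<in>S. real (N s)) / 2 \<le> real (card (sieve_set S W N))"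
proof -
  define M where "M = card S"
  define w where "w = 16 * (M\<^sup>2 + 1)"
  define W where "W = (fact w :: nat)"
  define N0 where "N0 = 192 * W * (M + 1)\<^sup>2"
  have W: "W \<ge> 1" by (simp add: W_def)
  have w: "w \<ge> 1" by (simp add: w_def)
  have N0: "N0 \<ge> 1" using W by (simp add: N0_def)
  have main: "(\<Prod>s\<in>S. real (N s)) / 2 \<le> real (card (sieve_set S W N))" (is "_ \<le> real (card ?G)")
    if N: "\<And>s. s \<in> S \<Longrightarrow> N s \<ge> N0" for N :: "'a \<Rightarrow> nat"
  proof -
    define I where "I s = {N s<..2 * N s}" for s
    define P where "P = (\<Prod>s\<in>S. real (N s))"
    define A where "A s d = PiE S (\<lambda>u. if u \<in> {s} then {k \<in> I u. d\<^sup>2 dvd 1 + W * k} else I u)" for s d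
    define C where "C s t d = PiE S (\<lambda>u. if u \<in> {s, t} then {k \<in> I u. d dvd 1 + W * k} else I u)" for s t d
    define D where "D s = {d. prime d \<and> w < d \<and> coprime d W \<and> d\<^sup>2 \<le> 3 * W * N s}" for s
    define E where "E s t = {d. prime d \<and> w < d \<and> coprime d W \<and> d \<le> 3 * W * min (N s) (N t)}" for s t
    define Q where "Q = {(s, t) \<in> S \<times> S. s \<noteq> t}"
    have cardI: "card (I s) = N s" for s by (simp add: I_def)
    have P0: "P \<ge> 0" by (auto simp: P_def intro: prod_nonneg)
    have N1: "N s \<ge> 1" if "s \<in> S" for s using N[OF that] N0 by simp
    have finQ: "finite Q" by (rule finite_subset[of _ "S \<times> S"]) (use S in \<open>auto simp: Q_def\<close>)
    have cardQ: "card Q \<le> M\<^sup>2"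
    proof -
      have "card Q \<le> card (S \<times> S)" using S by (intro card_mono) (auto simp: Q_def)
      then show ?thesis by (simp add: M_def power2_eq_square card_cartesian_product)
    qed
    have Dsub: "D s \<subseteq> {w<..nat \<lfloor>sqrt (3 * W * N s)\<rfloor>}" for s
    proof
      fix d assume d: "d \<in> D s"
      then have "real (d\<^sup>2) \<le> real (3 * W * N s)" unfolding D_def by (intro of_nat_mono) auto
      then have "real d \<le> sqrt (3 * W * N s)" by (intro real_le_rsqrt) simp
      then show "d \<in> {w<..nat \<lfloor>sqrt (3 * W * N s)\<rfloor>}" using d by (auto simp: D_def le_nat_floor)
    qed
    have finD: "finite (D s)" for s using Dsub finite_subset by blast
    have finE: "finite (E s t)" for s t
      by (rule finite_subset[of _ "{..3 * W * min (N s) (N t)}"]) (auto simp: E_def)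
    have finA: "finite (A s d)" for s d unfolding A_def by (intro finite_PiE S) (auto simp: I_def)
    have finC: "finite (C s t d)" for s t d unfolding C_def by (intro finite_PiE S) (auto simp: I_def)
    have "PiE S I \<subseteq> ?G \<union> (\<Union>s\<in>S. \<Union>d\<in>D s. A s d) \<union> (\<Union>(s, t)\<in>Q. \<Union>d\<in>E s t. C s t d)"
    proof
      fix k assume k: "k \<in> PiE S I"
      have k': "1 + W * k s \<le> 3 * W * N s" if "s \<in> S" for s
        using k that N1[OF that] by (intro Suc_mult_le W) (auto simp: I_def PiE_def Pi_def)
      show "k \<in> ?G \<union> (\<Union>s\<in>S. \<Union>d\<in>D s. A s d) \<union> (\<Union>(s, t)\<in>Q. \<Union>d\<in>E s t. C s t d)"
      proof (cases "k \<in> ?G")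
        case False
        then consider s where "s \<in> S" "\<not> squarefree (1 + W * k s)"
          | s t where "s \<in> S" "t \<in> S" "s \<noteq> t" "\<not> coprime (1 + W * k s) (1 + W * k t)"
          using k by (auto simp: I_def sieve_set_def)
        then show ?thesis
        proof cases
          case (1 s)
          then obtain p where p: "prime p" "p\<^sup>2 dvd 1 + W * k s"
            using not_squarefree_prime_square[of "1 + W * k s"] by auto
          have "p dvd 1 + W * k s" using p(2) by (metis dvd_mult_left power2_eq_square)
          note * = prime_dvd_Suc_fact_mult[OF p(1) this[unfolded W_def]]
          have "p\<^sup>2 \<le> 3 * W * N s" using dvd_imp_le[OF p(2)] k'[OF 1(1)] by linarith
          then have "p \<in> D s" using p * by (auto simp: D_def W_def)
          moreover have "k \<in> A s p" using k p(2) by (auto simp: A_def PiE_def Pi_def)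
          ultimately show ?thesis using 1(1) by blast
        next
          case (2 s t)
          then obtain p where p: "prime p" "p dvd 1 + W * k s" "p dvd 1 + W * k t"
            using not_coprime_common_prime by blast
          note * = prime_dvd_Suc_fact_mult[OF p(1) p(2)[unfolded W_def]]
          have "p \<le> 3 * W * N s" "p \<le> 3 * W * N t"
            using dvd_imp_le[OF p(2)] dvd_imp_le[OF p(3)] k'[OF 2(1)] k'[OF 2(2)] by linarith+
          then have "p \<in> E s t" using p * by (auto simp: E_def W_def min_def)
          moreover have "k \<in> C s t p" using k p by (auto simp: C_def PiE_def Pi_def)
          moreover have "(s, t) \<in> Q" using 2 by (simp add: Q_def)
          ultimately show ?thesis by blast
        qed
      qed blast
    qed
    moreover have "finite ?G"
      by (rule finite_subset[of _ "PiE S I"]) (auto simp: I_def sieve_set_def intro!: finite_PiE S)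
    ultimately have "card (PiE S I) \<le>
       card (?G \<union> (\<Union>s\<in>S. \<Union>d\<in>D s. A s d) \<union> (\<Union>(s, t)\<in>Q. \<Union>d\<in>E s t. C s t d))"
      using S finA finC finD finE finQ by (intro card_mono) auto
    also have "\<dots> \<le> card ?G + card (\<Union>s\<in>S. \<Union>d\<in>D s. A s d) + card (\<Union>(s, t)\<in>Q. \<Union>d\<in>E s t. C s t d)"
      by (meson add_le_mono1 card_Un_le le_trans)
    also have "card (\<Union>s\<in>S. \<Union>d\<in>D s. A s d) \<le> (\<Sum>s\<in>S. \<Sum>d\<in>D s. card (A s d))"
      by (rule order_trans[OF card_UN_le[OF S]]) (intro sum_mono card_UN_le finD)
    also have "card (\<Union>(s, t)\<in>Q. \<Union>d\<in>E s t. C s t d) \<le> (\<Sum>(s, t)\<in>Q. \<Sum>d\<in>E s t. card (C s t d))"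
      by (rule order_trans[OF card_UN_le[OF finQ]]) (auto intro!: sum_mono card_UN_le finE)
    finally have "card (PiE S I) \<le> card ?G + (\<Sum>s\<in>S. \<Sum>d\<in>D s. card (A s d))
       + (\<Sum>(s, t)\<in>Q. \<Sum>d\<in>E s t. card (C s t d))" by simp
    then have "real (card (PiE S I)) \<le> real (card ?G + (\<Sum>s\<in>S. \<Sum>d\<in>D s. card (A s d))
       + (\<Sum>(s, t)\<in>Q. \<Sum>d\<in>E s t. card (C s t d)))" by (rule of_nat_mono)
    moreover have "real (card (PiE S I)) = P" using S by (simp add: card_PiE cardI P_def)
    ultimately have union: "P \<le> real (card ?G) + (\<Sum>s\<in>S. \<Sum>d\<in>D s. real (card (A s d)))
       + (\<Sum>(s, t)\<in>Q. \<Sum>d\<in>E s t. real (card (C s t d)))" by (simp add: case_prod_unfold)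

    have Abound: "(\<Sum>d\<in>D s. real (card (A s d))) \<le> (1 / w + 1 / (8 * (real M + 1))) * P"
      if s: "s \<in> S" for s
    proof -
      define r where "r = nat \<lfloor>sqrt (3 * W * N s)\<rfloor>"
      have "real (card (A s d)) \<le> (1 / (real d)\<^sup>2 + 1 / real (N s)) * P" if d: "d \<in> D s" for d
      proof -
        have "d > 0" using d by (auto simp: D_def prime_gt_0_nat)
        have "real (card (A s d)) \<le> (1 / (real d)\<^sup>2 + 1 / real (N s)) ^ card {s} * P"
          unfolding A_def P_def
        proof (rule card_restrict_PiE_le[OF S])
          fix u assume u: "u \<in> {s}"
          have "real (card {k \<in> I u. d\<^sup>2 dvd 1 + W * k}) \<le> real (N u) / real (d\<^sup>2) + 1"
            unfolding I_def using d \<open>d > 0\<close> by (intro card_dvd_affine_le) (auto simp: D_def)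
          also have "\<dots> = (1 / (real d)\<^sup>2 + 1 / real (N s)) * real (N u)"
            using u N1[OF s] by (simp add: field_simps)
          finally show "real (card {k \<in> I u. d\<^sup>2 dvd 1 + W * k}) \<le> (1 / (real d)\<^sup>2 + 1 / real (N s)) * real (N u)" .
        qed (use s cardI in auto)
        then show ?thesis by simp
      qed
      then have "(\<Sum>d\<in>D s. real (card (A s d))) \<le> (\<Sum>d\<in>D s. (1 / (real d)\<^sup>2 + 1 / real (N s)) * P)"
        by (rule sum_mono)
      also have "\<dots> \<le> (\<Sum>d\<in>{w<..r}. (1 / (real d)\<^sup>2 + 1 / real (N s)) * P)"
        using Dsub[of s] P0 by (intro sum_mono2) (auto simp: r_def)
      also have "\<dots> = ((\<Sum>d\<in>{w<..r}. 1 / (real d)\<^sup>2) + real (r - w) / real (N s)) * P"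
        by (simp add: sum.distrib sum_distrib_right distrib_right)
      also have "\<dots> \<le> (1 / w + 1 / (8 * (real M + 1))) * P"
      proof (intro mult_right_mono add_mono P0 sum_inverse_squares_tail_le w)
        have "real (r - w) \<le> real r" by simp
        also have "\<dots> \<le> sqrt (3 * W * N s)" unfolding r_def by (simp add: of_nat_floor)
        also have "\<dots> \<le> real (N s) / (8 * (real M + 1))"
        proof (rule real_le_lsqrt)
          have "real N0 * real (N s) \<le> real (N s) * real (N s)"
            using N[OF s] by (intro mult_right_mono) auto
          then have "real (3 * W * N s) * (8 * (real M + 1))\<^sup>2 \<le> (real (N s))\<^sup>2"
            by (simp add: N0_def power2_eq_square algebra_simps)
          moreover have "(8 * (real M + 1))\<^sup>2 > 0" by simp
          ultimately show "real (3 * W * N s) \<le> (real (N s) / (8 * (real M + 1)))\<^sup>2"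
            by (simp only: power_divide pos_le_divide_eq)
        qed auto
        finally show "real (r - w) / real (N s) \<le> 1 / (8 * (real M + 1))"
          using N1[OF s] by (simp add: field_simps)
      qed
      finally show ?thesis .
    qed

    have Cbound: "(\<Sum>d\<in>E s t. real (card (C s t d))) \<le> (2 / w + 1 / (32 * (real M + 1)\<^sup>2)) * P"
      if st: "(s, t) \<in> Q" for s t
    proof -
      define m where "m = min (N s) (N t)"
      have S2: "s \<in> S" "t \<in> S" "s \<noteq> t" using st by (auto simp: Q_def)
      have m: "m \<ge> N0" "m \<ge> 1" using N S2 N1 by (auto simp: m_def)
      have "real (card (C s t d)) \<le> (2 * (1 / (real d)\<^sup>2) + 2 / (real m)\<^sup>2) * P" if d: "d \<in> E s t" for d
      proof -
        have "d > 0" using d by (auto simp: E_def prime_gt_0_nat)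
        have "real (card (C s t d)) \<le> (1 / real d + 1 / real m) ^ card {s, t} * P"
          unfolding C_def P_def
        proof (rule card_restrict_PiE_le[OF S])
          fix u assume u: "u \<in> {s, t}"
          have "real (card {k \<in> I u. d dvd 1 + W * k}) \<le> real (N u) / real d + 1"
            unfolding I_def using d \<open>d > 0\<close> by (intro card_dvd_affine_le) (auto simp: E_def)
          also have "1 \<le> real (N u) / real m" using m u by (auto simp: m_def)
          finally show "real (card {k \<in> I u. d dvd 1 + W * k}) \<le> (1 / real d + 1 / real m) * real (N u)"
            by (simp add: field_simps)
        qed (use S2 cardI in auto)
        also have "(1 / real d + 1 / real m) ^ card {s, t} = (1 / real d + 1 / real m)\<^sup>2"
          using S2(3) by (simp add: card_insert_if numeral_2_eq_2)
        also have "\<dots> \<le> 2 * (1 / real d)\<^sup>2 + 2 * (1 / real m)\<^sup>2"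
          unfolding power2_sum using sum_squares_bound[of "1 / real d" "1 / real m"] by linarith
        also have "\<dots> = 2 * (1 / (real d)\<^sup>2) + 2 / (real m)\<^sup>2" by (simp add: power_divide)
        finally show ?thesis using P0 by (simp only: mult_right_mono)
      qed
      then have "(\<Sum>d\<in>E s t. real (card (C s t d))) \<le> (\<Sum>d\<in>E s t. (2 * (1 / (real d)\<^sup>2) + 2 / (real m)\<^sup>2) * P)"
        by (rule sum_mono)
      also have "\<dots> \<le> (\<Sum>d\<in>{w<..3 * W * m}. (2 * (1 / (real d)\<^sup>2) + 2 / (real m)\<^sup>2) * P)"
        using P0 by (intro sum_mono2) (auto simp: E_def m_def)
      also have "\<dots> = (2 * (\<Sum>d\<in>{w<..3 * W * m}. 1 / (real d)\<^sup>2) + real (3 * W * m - w) * 2 / (real m)\<^sup>2) * P"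
        by (simp add: sum.distrib sum_distrib_right sum_distrib_left distrib_right)
      also have "\<dots> \<le> (2 * (1 / w) + 1 / (32 * (real M + 1)\<^sup>2)) * P"
      proof (intro mult_right_mono add_mono P0 sum_inverse_squares_tail_le w mult_left_mono)
        have "real (3 * W * m - w) \<le> real (3 * W * m)" by (intro of_nat_mono) simp
        then have "real (3 * W * m - w) * 2 / (real m)\<^sup>2 \<le> real (3 * W * m) * 2 / (real m)\<^sup>2"
          by (intro divide_right_mono mult_right_mono) auto
        also have "\<dots> = 6 * real W / real m" using m(2) by (simp add: power2_eq_square)
        also have "\<dots> \<le> 6 * real W / real N0" using m N0 by (intro divide_left_mono) auto
        also have "\<dots> = 1 / (32 * (real M + 1)\<^sup>2)" using W by (simp add: N0_def add.commute)
        finally show "real (3 * W * m - w) * 2 / (real m)\<^sup>2 \<le> 1 / (32 * (real M + 1)\<^sup>2)" .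
      qed auto
      finally show ?thesis by simp
    qed

    define \<alpha> where "\<alpha> = 1 / w + 1 / (8 * (real M + 1))"
    define \<gamma> where "\<gamma> = 2 / w + 1 / (32 * (real M + 1)\<^sup>2)"
    have "(\<Sum>s\<in>S. \<Sum>d\<in>D s. real (card (A s d))) \<le> (\<Sum>s\<in>S. \<alpha> * P)"
      using Abound by (intro sum_mono) (simp add: \<alpha>_def)
    then have 1: "(\<Sum>s\<in>S. \<Sum>d\<in>D s. real (card (A s d))) \<le> real M * (\<alpha> * P)" by (simp add: M_def)
    have "(\<Sum>(s, t)\<in>Q. \<Sum>d\<in>E s t. real (card (C s t d))) \<le> (\<Sum>(s, t)\<in>Q. \<gamma> * P)"
      by (rule sum_mono) (use Cbound in \<open>auto simp: \<gamma>_def\<close>)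
    also have "\<dots> = real (card Q) * (\<gamma> * P)" by (simp add: case_prod_unfold)
    also have "\<dots> \<le> real (M\<^sup>2) * (\<gamma> * P)"
      using cardQ P0 by (intro mult_right_mono of_nat_mono) (auto simp: \<gamma>_def)
    finally have 2: "(\<Sum>(s, t)\<in>Q. \<Sum>d\<in>E s t. real (card (C s t d))) \<le> real (M\<^sup>2) * (\<gamma> * P)" .
    have "real M * \<alpha> + real (M\<^sup>2) * \<gamma> \<le> 1 / 2"
    proof -
      define x where "x = real (M\<^sup>2)"
      have x: "x \<ge> 0" "real w = 16 * (x + 1)" by (simp_all add: x_def w_def)
      have "M \<le> M\<^sup>2 + 1" by (cases M) (simp_all add: power2_eq_square)
      then have "real M \<le> x + 1" unfolding x_def by linarith
      then have "real M / w \<le> 1 / 16" using x by (simp add: divide_le_eq)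
      moreover have "x * 2 / w \<le> 1 / 8" using x by (simp add: divide_le_eq)
      moreover have "real M / (8 * (real M + 1)) \<le> 1 / 8" by (simp add: divide_le_eq)
      moreover have "x / (32 * (real M + 1)\<^sup>2) \<le> 1 / 32"
      proof -
        have "x \<le> (real M + 1)\<^sup>2" unfolding x_def of_nat_power by (intro power_mono) auto
        moreover have *: "32 * (real M + 1)\<^sup>2 > 0" by simp
        ultimately show ?thesis unfolding pos_divide_le_eq[OF *] by linarith
      qed
      moreover have "real M * \<alpha> + x * \<gamma> = real M / w + real M / (8 * (real M + 1)) +
          (x * 2 / w + x / (32 * (real M + 1)\<^sup>2))"
        unfolding \<alpha>_def \<gamma>_def distrib_left by simp
      ultimately show ?thesis unfolding x_def[symmetric] by linarith
    qed
    then have "(real M * \<alpha> + real (M\<^sup>2) * \<gamma>) * P \<le> 1 / 2 * P"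
      using P0 by (rule mult_right_mono)
    then have "real M * (\<alpha> * P) + real (M\<^sup>2) * (\<gamma> * P) \<le> P / 2" by (simp only: distrib_right mult.assoc)
    then show ?thesis using union 1 2 unfolding P_def[symmetric] by linarith
  qed
  from W main show ?thesis by blast
qed

subsection \<open>Counting points\<close>

lemma multiplicity_squarefree:
  fixes m :: nat
  assumes "squarefree m" "prime p" "m > 0"
  shows "multiplicity p m = (if p dvd m then 1 else 0)"
  using assms squarefree_factorial_semiring'[of m]
  by (auto simp: not_dvd_imp_multiplicity_0 prime_factors_dvd)

definition squarefree_family :: "'a set \<Rightarrow> ('a \<Rightarrow> nat) \<Rightarrow> bool" where
  "squarefree_family S m \<longleftrightarrow> (\<forall>s\<in>S. m s > 0 \<and> squarefree (m s)) \<and>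
     (\<forall>s\<in>S. \<forall>t\<in>S. s \<noteq> t \<longrightarrow> coprime (m s) (m t))"

lemma multiplicity_prod_squarefree_family:
  assumes S: "finite S" "squarefree_family S m" and p: "prime p"
  shows "multiplicity p (\<Prod>h\<in>S. m h ^ f h) = (\<Sum>h\<in>S. if p dvd m h then f h else 0)"
proof -
  have "multiplicity p (\<Prod>h\<in>S. m h ^ f h) = (\<Sum>h\<in>S. multiplicity p (m h ^ f h))"
    using S p by (intro prime_elem_multiplicity_prod_distrib) (auto simp: squarefree_family_def)
  also have "\<dots> = (\<Sum>h\<in>S. if p dvd m h then f h else 0)"
    using S(2) p by (intro sum.cong)
      (auto simp: prime_elem_multiplicity_power_distrib multiplicity_squarefree squarefree_family_def)
  finally show ?thesis .
qed

lemma multiplicity_prod_squarefree_family_dvd: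
  assumes S: "finite S" "squarefree_family S m" and p: "prime p" and g: "g \<in> S" "p dvd m g"
  shows "multiplicity p (\<Prod>h\<in>S. m h ^ f h) = f g"
proof -
  have "p dvd m h \<longleftrightarrow> h = g" if "h \<in> S" for h
    using S(2) that g p by (metis coprime_common_divisor not_prime_unit squarefree_family_def)
  then have "(\<Sum>h\<in>S. if p dvd m h then f h else 0) = (\<Sum>h\<in>S. if h = g then f h else 0)"
    by (intro sum.cong) auto
  also have "\<dots> = f g" using S g by simp
  finally show ?thesis using multiplicity_prod_squarefree_family[OF S p] by simp
qed

lemma card_le_point_count:
  assumes S: "finite S" "S \<subseteq> Tset n q"
    and G: "G \<subseteq> PiE S (\<lambda>_. UNIV)" "\<And>m. m \<in> G \<Longrightarrow> squarefree_family S m"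
    and B: "\<And>m i. m \<in> G \<Longrightarrow> i \<le> n \<Longrightarrow> real (\<Prod>g\<in>S. m g ^ g i) \<le> B"
  shows "card G \<le> point_count n q B"
proof -
  define X where "X = {y \<in> {0..n} \<rightarrow>\<^sub>E {1..}.
     real (MAX i\<in>{0..n}. y i) \<le> B \<and>
     (\<forall>p. prime p \<longrightarrow> (\<lambda>i. if i \<le> n then multiplicity p (y i) else 0) \<in> Mset n q)}"
  define Y where "Y m = restrict (\<lambda>i. \<Prod>g\<in>S. m g ^ g i) {0..n}" for m :: "(nat \<Rightarrow> nat) \<Rightarrow> nat"
  have beyond: "g i = 0" if "g \<in> S" "i > n" for g i using that S by (auto simp: Tset_def Mset_def)
  have zero: "(\<lambda>_. 0) \<in> Mset n q" by (auto simp: Mset_def)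
  have "finite X"
  proof (rule finite_subset)
    show "X \<subseteq> PiE {0..n} (\<lambda>_. {1..nat \<lfloor>B\<rfloor>})"
    proof
      fix y assume y: "y \<in> X"
      have "y i \<le> nat \<lfloor>B\<rfloor>" if "i \<le> n" for i
      proof -
        have "y i \<le> (MAX i\<in>{0..n}. y i)" using that by (intro Max_ge) auto
        then have "real (y i) \<le> B" using y unfolding X_def by (auto intro: order_trans[rotated])
        then show ?thesis by (rule le_nat_floor)
      qed
      then show "y \<in> PiE {0..n} (\<lambda>_. {1..nat \<lfloor>B\<rfloor>})" using y by (auto simp: X_def PiE_def Pi_def)
    qed
  qed (auto intro: finite_PiE)
  moreover have "Y ` G \<subseteq> X"
  proof safe
    fix m assume m: "m \<in> G"
    have pos: "(\<Prod>g\<in>S. m g ^ g i) \<ge> 1" for i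
      using G(2)[OF m] by (auto simp: squarefree_family_def Suc_le_eq intro!: prod_pos)
    have "Y m \<in> {0..n} \<rightarrow>\<^sub>E {1..}" using pos by (auto simp: Y_def)
    moreover have "real (MAX i\<in>{0..n}. Y m i) \<le> B"
    proof -
      have "(MAX i\<in>{0..n}. Y m i) \<in> Y m ` {0..n}" by (intro Max_in) auto
      then obtain i where "(MAX i\<in>{0..n}. Y m i) = Y m i" "i \<in> {0..n}" by (rule imageE)
      then show ?thesis using B[OF m] by (simp add: Y_def)
    qed
    moreover have "(\<lambda>i. if i \<le> n then multiplicity p (Y m i) else 0) \<in> Mset n q" if p: "prime p" for p
    proof (cases "\<exists>g\<in>S. p dvd m g")
      case True
      then obtain g where g: "g \<in> S" "p dvd m g" by blast
      have "(\<lambda>i. if i \<le> n then multiplicity p (Y m i) else 0) = g"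
        using multiplicity_prod_squarefree_family_dvd[where m = m and g = g, OF S(1) G(2)[OF m] p g] beyond[OF g(1)]
        by (auto simp: Y_def fun_eq_iff)
      then show ?thesis using g S(2) by (auto simp: Tset_def)
    next
      case False
      then have "(\<lambda>i. if i \<le> n then multiplicity p (Y m i) else 0) = (\<lambda>_. 0)"
        using multiplicity_prod_squarefree_family[OF S(1) G(2)[OF m] p]
        by (auto simp: Y_def fun_eq_iff)
      then show ?thesis using zero by simp
    qed
    ultimately show "Y m \<in> X" by (simp add: X_def)
  qed
  moreover have "inj_on Y G"
  proof (rule inj_onI)
    have dvd: "p dvd m' g" if m: "m \<in> G" "m' \<in> G" "Y m = Y m'" and p: "prime p" and g: "g \<in> S" "p dvd m g" for m m' p g
    proof -
      have Y: "(\<Prod>h\<in>S. m h ^ h i) = (\<Prod>h\<in>S. m' h ^ h i)" if "i \<le> n" for i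
        using fun_cong[OF m(3), of i] that by (simp add: Y_def)
      have gi: "multiplicity p (\<Prod>h\<in>S. m' h ^ h i) = g i" if "i \<le> n" for i
        using multiplicity_prod_squarefree_family_dvd[where m = m and g = g and f = "\<lambda>h. h i", OF S(1) G(2)[OF m(1)] p g] Y[OF that] by simp
      obtain i where i: "i \<le> n" "g i \<ge> 1" using Tset_ge_1[of g n q] g S(2) by blast
      have "\<exists>h\<in>S. p dvd m' h"
      proof (rule ccontr)
        assume "\<not> ?thesis"
        then have "multiplicity p (\<Prod>h\<in>S. m' h ^ h i) = 0"
          using multiplicity_prod_squarefree_family[OF S(1) G(2)[OF m(2)] p] by auto
        then show False using gi i by simp
      qed
      then obtain h where h: "h \<in> S" "p dvd m' h" by blast
      have "h i = g i" for i
        using multiplicity_prod_squarefree_family_dvd[where m = m' and g = h, OF S(1) G(2)[OF m(2)] p h] gi[of i] beyond[OF g(1), of i] beyond[OF h(1), of i]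
        by (cases "i \<le> n") auto
      then have "h = g" by blast
      then show ?thesis using h by simp
    qed
    fix m m' assume m: "m \<in> G" "m' \<in> G" "Y m = Y m'"
    have "m g = m' g" if g: "g \<in> S" for g
    proof (rule multiplicity_eq_nat)
      have *: "m g > 0" "squarefree (m g)" "m' g > 0" "squarefree (m' g)"
        using G(2)[OF m(1)] G(2)[OF m(2)] g by (auto simp: squarefree_family_def)
      then show "m g > 0" "m' g > 0" by auto
      fix p :: nat assume p: "prime p"
      have "p dvd m g \<longleftrightarrow> p dvd m' g"
        using dvd[OF m p g] dvd[OF m(2,1) m(3)[symmetric] p g] by blast
      then show "multiplicity p (m g) = multiplicity p (m' g)"
        using * p by (simp add: multiplicity_squarefree)
    qed
    then show "m = m'" using m G(1) by (intro PiE_ext[of m S "\<lambda>_. UNIV"]) auto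
  qed
  ultimately have "card G \<le> card X" by (metis card_inj_on_le)
  then show ?thesis by (simp add: point_count_def X_def)
qed

lemma point_count_ge_1:
  assumes "B \<ge> 1"
  shows "point_count n q B \<ge> 1"
  using card_le_point_count[of "{}" n q "{\<lambda>_. undefined}" B] assms
  by (simp add: squarefree_family_def)

lemma point_count_ge_sum:
  fixes W H :: nat and S :: "(nat \<Rightarrow> nat) set"
  assumes S: "finite S" "S \<subseteq> Tset n q" and W: "W \<ge> 1" and N0: "N0 \<ge> 1"
    and sieve: "\<And>N. (\<forall>s\<in>S. N s \<ge> N0) \<Longrightarrow> (\<Prod>s\<in>S. real (N s)) / 2 \<le> real (card (sieve_set S W N))"
    and E: "finite E" "E \<subseteq> PiE S (\<lambda>_. UNIV)" "\<And>e g. e \<in> E \<Longrightarrow> g \<in> S \<Longrightarrow> e g \<ge> N0"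
    and B: "\<And>e i. e \<in> E \<Longrightarrow> i \<le> n \<Longrightarrow> (3 * real W) ^ (\<Sum>g\<in>S. g i) * 2 ^ (\<Sum>g\<in>S. e g * g i) \<le> B"
  shows "(\<Sum>e\<in>E. 2 ^ (\<Sum>g\<in>S. e g) / 2) \<le> real (point_count n q B)"
proof -
  define K where "K e = sieve_set S W (\<lambda>s. 2 ^ e s)" for e :: "(nat \<Rightarrow> nat) \<Rightarrow> nat"
  define m where "m = (\<lambda>(e :: (nat \<Rightarrow> nat) \<Rightarrow> nat, k). restrict (\<lambda>g. 1 + W * k g) S)"
  have finK: "finite (K e)" for e
    by (rule finite_subset[of _ "PiE S (\<lambda>s. {2 ^ e s<..2 * 2 ^ e s})"]) (auto simp: K_def sieve_set_def intro: finite_PiE S)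
  have Kb: "2 ^ e g < k g" "k g \<le> 2 * 2 ^ e g" if "k \<in> K e" "g \<in> S" for e k g
    using that by (auto simp: K_def sieve_set_def PiE_def Pi_def)
  have "inj_on m (Sigma E K)"
  proof (rule inj_onI, clarify)
    fix e k e' k' assume *: "e \<in> E" "k \<in> K e" "e' \<in> E" "k' \<in> K e'" "m (e, k) = m (e', k')"
    have k: "k g = k' g" if "g \<in> S" for g
      using fun_cong[OF *(5), of g] that W by (simp add: m_def)
    have "k = k'" using *(2,4) k by (intro extensionalityI[of k S]) (auto simp: K_def sieve_set_def PiE_def)
    moreover have "e g = e' g" if g: "g \<in> S" for g
    proof -
      have "(2::nat) ^ e g < 2 ^ Suc (e' g)" "(2::nat) ^ e' g < 2 ^ Suc (e g)"
        using Kb[OF *(2) g] Kb[OF *(4) g] k[OF g] by auto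
      then have "e g < Suc (e' g)" "e' g < Suc (e g)" by (metis one_less_numeral_iff power_less_imp_less_exp semiring_norm(76))+
      then show ?thesis by simp
    qed
    then have "e = e'" using *(1,3) E(2) by (intro PiE_ext[of e S "\<lambda>_. UNIV"]) auto
    ultimately show "e = e' \<and> k = k'" by simp
  qed
  then have "card (m ` Sigma E K) = (\<Sum>e\<in>E. card (K e))"
    using E(1) finK by (simp add: card_image)
  moreover have "card (m ` Sigma E K) \<le> point_count n q B"
  proof (rule card_le_point_count[OF S])
    show "m ` Sigma E K \<subseteq> PiE S (\<lambda>_. UNIV)" by (auto simp: m_def)
    fix x assume "x \<in> m ` Sigma E K"
    then obtain e k where ek: "e \<in> E" "k \<in> K e" "x = m (e, k)" by auto
    show "squarefree_family S x" using ek by (auto simp: m_def K_def sieve_set_def squarefree_family_def)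
    fix i assume i: "i \<le> n"
    have "real (\<Prod>g\<in>S. x g ^ g i) = (\<Prod>g\<in>S. real (x g) ^ g i)" by simp
    also have "\<dots> \<le> (\<Prod>g\<in>S. (3 * real W * 2 ^ e g) ^ g i)"
    proof (intro prod_mono conjI power_mono)
      fix g assume g: "g \<in> S"
      have "1 + W * k g \<le> 3 * W * 2 ^ e g"
        using Kb[OF ek(2) g] by (intro Suc_mult_le W) auto
      then have "real (1 + W * k g) \<le> real (3 * W * 2 ^ e g)" by (rule of_nat_mono)
      then show "real (x g) \<le> 3 * real W * 2 ^ e g" using g ek(3) by (simp add: m_def)
    qed auto
    also have "\<dots> = (3 * real W) ^ (\<Sum>g\<in>S. g i) * 2 ^ (\<Sum>g\<in>S. e g * g i)"
      by (simp add: power_mult_distrib prod.distrib power_sum power_mult)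
    also have "\<dots> \<le> B" by (rule B[OF ek(1) i])
    finally show "real (\<Prod>g\<in>S. x g ^ g i) \<le> B" .
  qed
  ultimately have "(\<Sum>e\<in>E. real (card (K e))) \<le> real (point_count n q B)" by (metis of_nat_le_iff of_nat_sum)
  moreover have "(\<Sum>e\<in>E. 2 ^ (\<Sum>g\<in>S. e g) / 2) \<le> (\<Sum>e\<in>E. real (card (K e)))"
  proof (rule sum_mono)
    fix e assume e: "e \<in> E"
    have "2 ^ e s \<ge> N0" if "s \<in> S" for s
      using E(3)[OF e that] by (meson le_trans less_exp less_imp_le)
    with sieve[of "\<lambda>s. 2 ^ e s"] show "2 ^ (\<Sum>g\<in>S. e g) / 2 \<le> real (card (K e))"
      by (simp add: K_def power_sum)
  qed
  ultimately show ?thesis by simp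
qed

lemma point_count_lower_bound_eventually:
  assumes fin: "finite (Tset n q)"
  obtains C X0 where "C > 0" "\<And>B. ln B \<ge> X0 \<Longrightarrow> B \<ge> 2 \<Longrightarrow>
    C * B powr lp_value n q * ln B ^ lp_face_dim n q \<le> real (point_count n q B)"
proof -
  from lp_lattice_points[OF fin] obtain S \<delta> \<eta> where S: "S \<subseteq> Tset n q" and pos: "\<delta> > (0::real)" "\<eta> > (0::real)" and
    lat: "\<forall>\<mu>>0. \<exists>E \<subseteq> PiE S (\<lambda>_. UNIV :: nat set). finite E \<and> (\<eta> * \<mu>) ^ lp_face_dim n q \<le> real (card E) \<and>
       (\<forall>e\<in>E. (\<forall>g\<in>S. \<delta> * \<mu> - 1 \<le> real (e g)) \<and>
          (\<forall>i\<le>n. (\<Sum>g\<in>S. real (e g) * real (g i)) \<le> \<mu>) \<and>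
          lp_value n q * \<mu> - real (card S) \<le> (\<Sum>g\<in>S. real (e g)))"
    by (elim exE conjE) (rule that; assumption)
  have finS: "finite S" using S fin finite_subset by blast
  obtain W N0 where W: "W \<ge> 1" and sieve: "\<forall>N. (\<forall>s\<in>S. N s \<ge> N0) \<longrightarrow>
      (\<Prod>s\<in>S. real (N s)) / 2 \<le> real (card (sieve_set S W N))"
    using half_le_card_sieve_set[OF finS] by blast
  define a where "a = lp_value n q"
  define b where "b = lp_face_dim n q"
  define H where "H = (\<Sum>i\<le>n. \<Sum>g\<in>S. g i)"
  define L where "L = (3 * real W) ^ H"
  have L: "L \<ge> 1" unfolding L_def using W by (intro one_le_power) simp
  define C where "C = (1 / L) powr a * 2 powr (- real (card S)) / 2 * (\<eta> / 2) ^ b"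
  define X0 where "X0 = max (2 * ln L) (2 * (real N0 + 2) / \<delta>)"
  have "C > 0" using L pos by (simp add: C_def)
  moreover have "C * B powr a * ln B ^ b \<le> real (point_count n q B)" if lnB: "ln B \<ge> X0" and B: "B \<ge> 2" for B
  proof -
    define \<mu> where "\<mu> = log 2 (B / L)"
    have \<mu>2: "2 powr \<mu> = B / L" using B L by (simp add: \<mu>_def)
    have "ln B > 0" using B by simp
    have \<mu>: "ln B / 2 \<le> \<mu>"
    proof -
      have "ln B / 2 \<le> ln B - ln L" using lnB by (simp add: X0_def)
      also have "\<dots> \<le> (ln B - ln L) / ln 2"
      proof -
        have "ln (2::real) \<le> 1" using ln_le_minus_one[of "2::real"] by simp
        moreover have "ln B - ln L \<ge> 0" using lnB \<open>ln B > 0\<close> by (simp add: X0_def)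
        ultimately show ?thesis by (simp add: le_divide_eq mult_left_le)
      qed
      also have "\<dots> = \<mu>" using B L by (simp add: \<mu>_def log_def ln_div)
      finally show ?thesis .
    qed
    then have "\<mu> > 0" using \<open>ln B > 0\<close> by simp
    from lat[rule_format, OF this] obtain E where E: "E \<subseteq> PiE S (\<lambda>_. UNIV :: nat set)" "finite E" "(\<eta> * \<mu>) ^ b \<le> real (card E)"
      and e1: "\<And>e g. e \<in> E \<Longrightarrow> g \<in> S \<Longrightarrow> \<delta> * \<mu> - 1 \<le> real (e g)"
      and e2: "\<And>e i. e \<in> E \<Longrightarrow> i \<le> n \<Longrightarrow> (\<Sum>g\<in>S. real (e g) * real (g i)) \<le> \<mu>"
      and e3: "\<And>e. e \<in> E \<Longrightarrow> a * \<mu> - real (card S) \<le> (\<Sum>g\<in>S. real (e g))"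
      unfolding a_def b_def by auto
    have "(\<Sum>e\<in>E. 2 ^ (\<Sum>g\<in>S. e g) / 2) \<le> real (point_count n q B)"
    proof (rule point_count_ge_sum[OF finS S W _ _ E(2,1), where ?N0.0 = "N0 + 1"])
      fix N :: "(nat \<Rightarrow> nat) \<Rightarrow> nat" assume "\<forall>s\<in>S. N0 + 1 \<le> N s"
      then show "(\<Prod>s\<in>S. real (N s)) / 2 \<le> real (card (sieve_set S W N))"
        by (intro sieve[rule_format]) (meson add_leD1)
    next
      fix e g assume e: "e \<in> E" "g \<in> S"
      have "2 * (real N0 + 2) / \<delta> \<le> 2 * \<mu>" using lnB \<mu> by (simp add: X0_def)
      then have "real N0 + 2 \<le> \<delta> * \<mu>" using pos by (simp add: divide_le_eq mult.commute)
      then show "N0 + 1 \<le> e g" using e1[of e g] e by linarith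
    next
      fix e i assume e: "e \<in> E" and i: "i \<le> n"
      have "(\<Sum>g\<in>S. g i) \<le> H" unfolding H_def
        by (rule member_le_sum[of i "{..n}" "\<lambda>i. \<Sum>g\<in>S. g i"]) (use i in auto)
      then have "(3 * real W) ^ (\<Sum>g\<in>S. g i) \<le> L"
        unfolding L_def using W by (intro power_increasing) auto
      moreover have "2 ^ (\<Sum>g\<in>S. e g * g i) \<le> B / L"
      proof -
        have "(2::real) ^ (\<Sum>g\<in>S. e g * g i) = 2 powr real (\<Sum>g\<in>S. e g * g i)"
          by (rule powr_realpow[symmetric]) simp
        also have "\<dots> \<le> 2 powr \<mu>" using e2[OF e i] by (intro powr_mono) auto
        finally show ?thesis by (simp add: \<mu>2)
      qed
      ultimately have "(3 * real W) ^ (\<Sum>g\<in>S. g i) * 2 ^ (\<Sum>g\<in>S. e g * g i) \<le> L * (B / L)"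
        using L by (intro mult_mono) auto
      also have "\<dots> = B" using L by simp
      finally show "(3 * real W) ^ (\<Sum>g\<in>S. g i) * 2 ^ (\<Sum>g\<in>S. e g * g i) \<le> B" .
    qed simp
    moreover have "real (card E) * (2 powr (a * \<mu> - real (card S)) / 2) \<le> (\<Sum>e\<in>E. 2 ^ (\<Sum>g\<in>S. e g) / 2)"
    proof -
      have "2 powr (a * \<mu> - real (card S)) / 2 \<le> 2 ^ (\<Sum>g\<in>S. e g) / 2" if "e \<in> E" for e
      proof -
        have "2 powr (a * \<mu> - real (card S)) \<le> 2 powr real (\<Sum>g\<in>S. e g)"
          using e3[OF that] by (intro powr_mono) auto
        then show ?thesis by (simp add: powr_realpow del: of_nat_sum)
      qed
      from sum_mono[of E, OF this] show ?thesis by simp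
    qed
    moreover have "2 powr (a * \<mu> - real (card S)) = B powr a * ((1 / L) powr a * 2 powr (- real (card S)))"
    proof -
      have "2 powr (a * \<mu> - real (card S)) = (2 powr \<mu>) powr a * 2 powr (- real (card S))"
        by (simp add: powr_powr mult.commute flip: powr_add)
      also have "(2 powr \<mu>) powr a = B powr a * (1 / L) powr a"
        unfolding \<mu>2 using B L by (simp flip: powr_mult)
      finally show ?thesis by simp
    qed
    moreover have "(\<eta> / 2) ^ b * ln B ^ b \<le> real (card E)"
    proof -
      have "(\<eta> / 2) ^ b * ln B ^ b = (\<eta> * (ln B / 2)) ^ b" by (simp add: power_mult_distrib power_divide)
      also have "\<dots> \<le> (\<eta> * \<mu>) ^ b" using pos \<mu> \<open>ln B > 0\<close> by (intro power_mono mult_left_mono) auto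
      finally show ?thesis using E(3) by simp
    qed
    then have "(\<eta> / 2) ^ b * ln B ^ b * (B powr a * ((1 / L) powr a * 2 powr (- real (card S))) / 2)
      \<le> real (card E) * (B powr a * ((1 / L) powr a * 2 powr (- real (card S))) / 2)"
      by (rule mult_right_mono) simp
    ultimately show ?thesis by (simp add: C_def mult_ac)
  qed
  ultimately show ?thesis using that unfolding a_def b_def by blast
qed

theorem lemma12:
  fixes n :: nat and q :: "nat \<Rightarrow> nat"
  assumes "n \<ge> 1"
    and "\<forall>i\<le>n. q i > 0"
    and "(GCD i\<in>{0..n}. q i) = 1"
  shows "\<exists>C>0. \<forall>B::real. B \<ge> 2 \<longrightarrow>
    real (point_count n q B) \<ge> C * B powr lp_value n q * ln B ^ lp_face_dim n q"
proof -
  define a where "a = lp_value n q"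
  define b where "b = lp_face_dim n q"
  obtain C X0 where C: "C > 0" and large: "\<And>B. ln B \<ge> X0 \<Longrightarrow> B \<ge> 2 \<Longrightarrow>
      C * B powr a * ln B ^ b \<le> real (point_count n q B)"
    using point_count_lower_bound_eventually[OF finite_Tset[OF assms(1,2)]] unfolding a_def b_def by metis
  define D where "D = exp (\<bar>a\<bar> * \<bar>X0\<bar>) * (\<bar>X0\<bar> + 1) ^ b"
  have D: "D > 0" by (simp add: D_def add_nonneg_pos)
  have "min C (1 / D) * B powr a * ln B ^ b \<le> real (point_count n q B)" if B: "B \<ge> 2" for B
  proof (cases "ln B \<ge> X0")
    case True
    have "min C (1 / D) * (B powr a * ln B ^ b) \<le> C * (B powr a * ln B ^ b)"
      using B by (intro mult_right_mono) auto
    then show ?thesis using large[OF True B] by (simp add: mult.assoc)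
  next
    case False
    have lnB: "ln B > 0" using B by simp
    have "B powr a * ln B ^ b \<le> D"
      unfolding D_def
    proof (intro mult_mono power_mono)
      have "a * ln B \<le> \<bar>a\<bar> * \<bar>X0\<bar>" using False lnB by (intro mult_mono) auto
      then show "B powr a \<le> exp (\<bar>a\<bar> * \<bar>X0\<bar>)" using B by (simp add: powr_def)
    qed (use False lnB in auto)
    then have "1 / D * (B powr a * ln B ^ b) \<le> 1" using D by (simp add: divide_le_eq)
    moreover have "min C (1 / D) * (B powr a * ln B ^ b) \<le> 1 / D * (B powr a * ln B ^ b)"
      using B by (intro mult_right_mono) auto
    ultimately show ?thesis using point_count_ge_1[of B n q] B by (simp add: mult.assoc)
  qed
  then show ?thesis using C D unfolding a_def b_def by (intro exI[of _ "min C (1 / D)"]) auto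
qed

end
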